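(* Let $k$ be a positive integer and let $G$ be an $(n-k-1)$-regular graph on $n$ vertices. Then $\mathrm{box}(G)\ge \frac{n}{2k}$.
   Context: Graphs are finite, simple and undirected. The boxicity $\mathrm{box}(G)$ is the minimum $k$ such that there are interval graphs $I_1,\dots,I_k$ on $V(G)$ with $E(G)=E(I_1)\cap\cdots\cap E(I_k)$ (equivalently, the minimum dimension of an intersection representation of $G$ by axis-parallel boxes). *)

theory Defs
  imports Complex_Main "Graph_Theory.Pair_Digraph"
begin

text \<open>
  A finite simple undirected graph is a \<^locale>\<open>pair_graph\<close>: a finite loop-free symmetric digraph
  whose arcs are ordered pairs, so that an edge \<open>uv\<close> is the pair of arcs \<open>(u,v)\<close> and \<open>(v,u)\<close>.
  The degree of a vertex is therefore its out-degree.
\<close>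

text \<open>The degree is an integer here so that differences such as \<open>n - k - 1\<close> are not truncated.\<close>

definition regular_graph :: "'a pair_pre_digraph \<Rightarrow> int \<Rightarrow> bool" where
  "regular_graph G d \<longleftrightarrow> (\<forall>v\<in>pverts G. int (out_degree (with_proj G) v) = d)"

definition interval_graph :: "'a pair_pre_digraph \<Rightarrow> bool" where
  "interval_graph I \<longleftrightarrow> pair_graph I \<and>
     (\<exists>l r :: 'a \<Rightarrow> real.
        (\<forall>v\<in>pverts I. l v \<le> r v) \<and>
        (\<forall>u\<in>pverts I. \<forall>v\<in>pverts I. u \<noteq> v \<longrightarrow>
           ((u, v) \<in> parcs I \<longleftrightarrow> {l u..r u} \<inter> {l v..r v} \<noteq> {})))"

text \<open>
  The edge set of \<open>G\<close> is the intersection of the edge sets of \<open>k\<close> interval graphs on the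
  same vertex set. The intersection is taken inside the set of all pairs of distinct vertices;
  this only matters for \<open>k = 0\<close>, where it gives the usual convention that complete graphs have
  boxicity 0.
\<close>

definition interval_representation ::
    "'a pair_pre_digraph \<Rightarrow> nat \<Rightarrow> (nat \<Rightarrow> 'a pair_pre_digraph) \<Rightarrow> bool" where
  "interval_representation G k I \<longleftrightarrow>
     (\<forall>i<k. interval_graph (I i) \<and> pverts (I i) = pverts G) \<and>
     parcs G = {(u, v) \<in> pverts G \<times> pverts G. u \<noteq> v} \<inter> (\<Inter>i<k. parcs (I i))"

definition boxicity :: "'a pair_pre_digraph \<Rightarrow> nat" where
  "boxicity G = (LEAST k. \<exists>I. interval_representation G k I)"

text \<open>The minimum is attained, since every graph has some interval representation.\<close>

lemma interval_representation_exists: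
  assumes "pair_graph G"
  shows "\<exists>k I. interval_representation G k I"
proof -
  interpret pair_graph G by fact
  define N where "N = {(u, v) \<in> pverts G \<times> pverts G. u \<noteq> v} - parcs G"
  have "finite N"
    unfolding N_def by (rule finite_subset[of _ "pverts G \<times> pverts G"]) (auto simp: pair_finite_verts)
  then obtain f and k :: nat where f: "N = f ` {i. i < k}"
    using finite_imp_nat_seg_image_inj_on by metis
  define J where "J = (\<lambda>(a, b). \<lparr>pverts = pverts G,
    parcs = {(u, v) \<in> pverts G \<times> pverts G. u \<noteq> v} - {(a, b), (b, a)}\<rparr>)"
  have symG: "(u, v) \<in> parcs G \<longleftrightarrow> (v, u) \<in> parcs G" for u v
    using pair_sym_arcs arcs_ends_symmetric[of "with_proj G"] by auto
  have J: "interval_graph (J (a, b))" if ab: "a \<noteq> b" for a b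
  proof -
    have "pair_graph (J (a, b))"
    proof unfold_locales
      show "finite (parcs (J (a, b)))"
        unfolding J_def
        by (rule finite_subset[of _ "pverts G \<times> pverts G"]) (auto simp: pair_finite_verts)
      show "symmetric (with_proj (J (a, b)))"
        unfolding symmetric_def by (auto simp: J_def sym_def)
    qed (auto simp: J_def pair_finite_verts)
    moreover have "\<exists>l r :: 'a \<Rightarrow> real.
        (\<forall>v\<in>pverts (J (a, b)). l v \<le> r v) \<and>
        (\<forall>u\<in>pverts (J (a, b)). \<forall>v\<in>pverts (J (a, b)). u \<noteq> v \<longrightarrow>
           ((u, v) \<in> parcs (J (a, b)) \<longleftrightarrow> {l u..r u} \<inter> {l v..r v} \<noteq> {}))"
      using ab
      by (intro exI[of _ "\<lambda>v. if v = b then 1 else 0"] exI[of _ "\<lambda>v. if v = a then 0 else 1"])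
        (auto simp: J_def)
    ultimately show ?thesis unfolding interval_graph_def by blast
  qed
  have "interval_representation G k (J \<circ> f)"
    unfolding interval_representation_def
  proof (intro conjI allI impI)
    fix i assume "i < k"
    then have "f i \<in> N" using f by auto
    then show "interval_graph ((J \<circ> f) i)"
      using J by (cases "f i") (auto simp: N_def)
    show "pverts ((J \<circ> f) i) = pverts G"
      by (cases "f i") (auto simp: J_def)
  next
    have "(\<Inter>i<k. parcs ((J \<circ> f) i)) = (\<Inter>e\<in>N. parcs (J e))"
      unfolding f by auto
    also have "{(u, v) \<in> pverts G \<times> pverts G. u \<noteq> v} \<inter> \<dots> = parcs G"
    proof (intro equalityI subrelI)
      fix u v assume uv: "(u, v) \<in> {(u, v) \<in> pverts G \<times> pverts G. u \<noteq> v} \<inter> (\<Inter>e\<in>N. parcs (J e))"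
      show "(u, v) \<in> parcs G"
      proof (rule ccontr)
        assume "(u, v) \<notin> parcs G"
        then have "(u, v) \<in> N" using uv by (auto simp: N_def)
        then have "(u, v) \<in> parcs (J (u, v))" using uv by blast
        then show False by (auto simp: J_def)
      qed
    next
      fix u v assume uv: "(u, v) \<in> parcs G"
      then have V: "u \<in> pverts G" "v \<in> pverts G" "u \<noteq> v"
        using in_arcsD1 in_arcsD2 pair_no_loops by fastforce+
      have "(u, v) \<in> parcs (J (a, b))" if "(a, b) \<in> N" for a b
        using that uv V symG by (auto simp: J_def N_def)
      then show "(u, v) \<in> {(u, v) \<in> pverts G \<times> pverts G. u \<noteq> v} \<inter> (\<Inter>e\<in>N. parcs (J e))"
        using V by auto
    qed
    finally show "parcs G = {(u, v) \<in> pverts G \<times> pverts G. u \<noteq> v} \<inter> (\<Inter>i<k. parcs ((J \<circ> f) i))"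
      by simp
  qed
  then show ?thesis by blast
qed

end

theory Submission
  imports Defs
begin

text \<open>
  The complement of \<open>G\<close> is \<open>k\<close>-regular, so it has \<open>n k\<close> arcs. Each of them is missing from some
  interval graph of a representation, so it is enough that every interval graph containing \<open>G\<close>
  misses at most \<open>2 k\<^sup>2\<close> arcs. A missing arc comes from an interval \<open>x\<close> lying entirely to the
  left of an interval \<open>y\<close>. Then \<open>y\<close> also lies to the right of the interval that ends first, and
  \<open>x\<close> to the left of the interval that starts last; by the degree condition there are at most
  \<open>k\<close> choices for each of \<open>x\<close> and \<open>y\<close>.
\<close>

lemma card_interval_order_le:
  fixes l r :: "'a \<Rightarrow> 'b::linorder"
  assumes "finite V"
    and right: "\<And>u. u \<in> V \<Longrightarrow> card {v \<in> V. r u < l v} \<le> k"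
    and left: "\<And>u. u \<in> V \<Longrightarrow> card {v \<in> V. r v < l u} \<le> k"
  shows "card {(u, v) \<in> V \<times> V. r u < l v} \<le> k * k"
proof (cases "V = {}")
  case False
  \<comment> \<open>\<open>a\<close> is a vertex whose interval ends first; \<open>b\<close> below
    is one whose interval starts last.\<close>
  obtain a where a: "a \<in> V" "\<And>v. v \<in> V \<Longrightarrow> r a \<le> r v"
    using ex_min_if_finite[of "r ` V"] \<open>finite V\<close> False by (auto simp: not_less)
  have "Max (l ` V) \<in> l ` V"
    using \<open>finite V\<close> False by simp
  then obtain b where "b \<in> V" "l b = Max (l ` V)"
    by force
  then have b: "b \<in> V" "\<And>v. v \<in> V \<Longrightarrow> l v \<le> l b"
    using \<open>finite V\<close> by simp_all
  \<comment> \<open>From \<open>r u < l v\<close> follow \<open>r u < l b\<close> and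
    \<open>r a < l v\<close>: each conjunct constrains only one coordinate, so the pairs lie in a
    product.\<close>
  have "{(u, v) \<in> V \<times> V. r u < l v} \<subseteq> {v \<in> V. r v < l b} \<times> {v \<in> V. r a < l v}"
    using less_le_trans[OF _ b(2)] le_less_trans[OF a(2)] by blast
  then have "card {(u, v) \<in> V \<times> V. r u < l v}
      \<le> card ({v \<in> V. r v < l b} \<times> {v \<in> V. r a < l v})"
    using \<open>finite V\<close> by (intro card_mono) auto
  also have "\<dots> \<le> k * k"
    unfolding card_cartesian_product using left[OF b(1)] right[OF a(1)] by (rule mult_le_mono)
  finally show ?thesis .
qed simp

text \<open>The arcs of the complement graph. Pairs are ordered, so a missing edge counts
  twice.\<close>

definition non_arcs :: "'a pair_pre_digraph \<Rightarrow> ('a \<times> 'a) set" where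
  "non_arcs G = {(u, v) \<in> pverts G \<times> pverts G. u \<noteq> v} - parcs G"

lemma finite_non_arcs:
  assumes "finite (pverts G)"
  shows "finite (non_arcs G)"
  unfolding non_arcs_def
  by (rule finite_subset[of _ "pverts G \<times> pverts G"]) (use assms in auto)

text \<open>The vertices split into \<open>v\<close>, its neighbours and its non-neighbours; the
  final 1 is \<open>v\<close> itself. Integers match \<open>regular_graph\<close> and avoid
  truncated subtraction.\<close>

lemma card_non_neighbours:
  assumes "pair_graph G" "v \<in> pverts G"
  shows "int (card {w. (v, w) \<in> non_arcs G})
    = int (card (pverts G)) - int (out_degree (with_proj G) v) - 1"
proof -
  interpret pair_graph G by fact
  let ?O = "out_arcs (with_proj G) v"
  have O: "?O = Pair v ` {w. (v, w) \<in> parcs G}"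
    unfolding out_arcs_def by auto
  have deg: "out_degree (with_proj G) v = card {w. (v, w) \<in> parcs G}"
    unfolding out_degree_def O by (rule card_image) (simp add: inj_on_def)
  have sub: "insert v {w. (v, w) \<in> parcs G} \<subseteq> pverts G"
    using in_arcsD2 assms(2) by blast
  have fin: "finite {w. (v, w) \<in> parcs G}"
    by (rule finite_subset[OF _ pair_finite_verts]) (use sub in simp)
  have v: "v \<notin> {w. (v, w) \<in> parcs G}"
    using pair_no_loops by fastforce
  have "{w. (v, w) \<in> non_arcs G} = pverts G - insert v {w. (v, w) \<in> parcs G}"
    using assms(2) unfolding non_arcs_def by auto
  then have "card {w. (v, w) \<in> non_arcs G} + Suc (card {w. (v, w) \<in> parcs G}) = card (pverts G)"
    using card_Diff_subset[OF _ sub] card_mono[OF pair_finite_verts sub] fin v by simp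
  then show ?thesis
    unfolding deg by linarith
qed

text \<open>Disjoint intervals are ordered left to right, which gives at most \<open>k * k\<close>
  ordered pairs; the factor 2 accounts for the reversed pairs.\<close>

lemma card_non_arcs_interval_graph_le:
  assumes I: "interval_graph I"
    and deg: "\<And>v. v \<in> pverts I \<Longrightarrow> card {w. (v, w) \<in> non_arcs I} \<le> k"
  shows "card (non_arcs I) \<le> 2 * (k * k)"
proof -
  interpret pair_graph I using I by (simp add: interval_graph_def)
  obtain l r :: "'a \<Rightarrow> real" where lr: "\<And>v. v \<in> pverts I \<Longrightarrow> l v \<le> r v"
    and arc: "\<And>u v. u \<in> pverts I \<Longrightarrow> v \<in> pverts I \<Longrightarrow> u \<noteq> v \<Longrightarrow>
      (u, v) \<in> parcs I \<longleftrightarrow> {l u..r u} \<inter> {l v..r v} \<noteq> {}"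
    using I unfolding interval_graph_def by blast
  \<comment> \<open>The diagonal is covered too: for \<open>u = v\<close> both sides are false, the
    right one by \<open>l u \<le> r u\<close>.\<close>
  have non_arc: "(u, v) \<in> non_arcs I \<longleftrightarrow> r u < l v \<or> r v < l u"
    if "u \<in> pverts I" "v \<in> pverts I" for u v
    using arc[OF that] lr[OF that(1)] lr[OF that(2)] that
    by (cases "u = v") (auto simp: non_arcs_def not_less)
  let ?D = "{(u, v) \<in> pverts I \<times> pverts I. r u < l v}"
  have fin: "finite {w. (u, w) \<in> non_arcs I}" for u
    by (rule finite_subset[OF _ pair_finite_verts]) (auto simp: non_arcs_def)
  have right: "card {v \<in> pverts I. r u < l v} \<le> k" if "u \<in> pverts I" for u
  proof -
    have "{v \<in> pverts I. r u < l v} \<subseteq> {w. (u, w) \<in> non_arcs I}"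
      using non_arc that by auto
    from card_mono[OF fin this] deg[OF that] show ?thesis by simp
  qed
  have left: "card {v \<in> pverts I. r v < l u} \<le> k" if "u \<in> pverts I" for u
  proof -
    have "{v \<in> pverts I. r v < l u} \<subseteq> {w. (u, w) \<in> non_arcs I}"
      using non_arc that by auto
    from card_mono[OF fin this] deg[OF that] show ?thesis by simp
  qed
  have D: "card ?D \<le> k * k"
    using pair_finite_verts right left by (rule card_interval_order_le)
  have finD: "finite ?D"
    by (rule finite_subset[of _ "pverts I \<times> pverts I"]) (use pair_finite_verts in auto)
  have "non_arcs I \<subseteq> ?D \<union> ?D\<inverse>"
  proof (rule subrelI)
    fix u v assume uv: "(u, v) \<in> non_arcs I"
    then have "u \<in> pverts I" "v \<in> pverts I" by (auto simp: non_arcs_def)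
    then show "(u, v) \<in> ?D \<union> ?D\<inverse>" using uv non_arc by auto
  qed
  then have "card (non_arcs I) \<le> card (?D \<union> ?D\<inverse>)"
    using finD by (intro card_mono) auto
  also have "\<dots> \<le> card ?D + card (?D\<inverse>)"
    by (rule card_Un_le)
  also have "\<dots> \<le> 2 * (k * k)"
    using D by simp
  finally show ?thesis .
qed

theorem theorem3:
  fixes G :: "'a pair_pre_digraph" and n k :: nat
  assumes "k \<ge> 1"
    and "pair_graph G"
    and "card (pverts G) = n"
    and "regular_graph G (int n - int k - 1)"
  shows "real (boxicity G) \<ge> real n / (2 * real k)"
proof -
  interpret pair_graph G by fact
  define b where "b = boxicity G"
  obtain I where I: "interval_representation G b I"
    using LeastI_ex[OF interval_representation_exists[OF assms(2)]]
    unfolding b_def boxicity_def by blast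
  have deg: "card {w. (v, w) \<in> non_arcs G} = k" if "v \<in> pverts G" for v
    using card_non_neighbours[OF assms(2) that] assms(3,4) that
    unfolding regular_graph_def by simp
  have fin: "finite (non_arcs G)"
    using pair_finite_verts by (rule finite_non_arcs)
  have fin_nb: "finite {w. (v, w) \<in> non_arcs G}" for v
    by (rule finite_subset[OF _ pair_finite_verts]) (auto simp: non_arcs_def)
  \<comment> \<open>Count the arcs of the complement by their first vertex: \<open>n\<close>
    vertices with \<open>k\<close> non-neighbours each.\<close>
  have "non_arcs G = (SIGMA v:pverts G. {w. (v, w) \<in> non_arcs G})"
    by (auto simp: non_arcs_def)
  then have "card (non_arcs G) = card (SIGMA v:pverts G. {w. (v, w) \<in> non_arcs G})"
    by (rule arg_cong)
  also have "\<dots> = n * k"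
    using pair_finite_verts fin_nb deg assms(3) by (simp add: card_SigmaI)
  finally have nk: "card (non_arcs G) = n * k" .
  \<comment> \<open>De Morgan on the common vertex set. For \<open>b = 0\<close> both sides are
    empty, since \<open>G\<close> is then complete.\<close>
  have cover: "non_arcs G = (\<Union>i<b. non_arcs (I i))"
    using I unfolding interval_representation_def non_arcs_def by auto
  have bound: "card (non_arcs (I i)) \<le> 2 * (k * k)" if "i < b" for i
  proof (rule card_non_arcs_interval_graph_le)
    show "interval_graph (I i)"
      using I that unfolding interval_representation_def by blast
    fix v assume "v \<in> pverts (I i)"
    then have v: "v \<in> pverts G"
      using I that unfolding interval_representation_def by blast
    \<comment> \<open>\<open>I i\<close> contains all arcs of \<open>G\<close>, so non-neighbours in
      \<open>I i\<close> are among the \<open>k\<close> non-neighbours in \<open>G\<close>.\<close>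
    have "{w. (v, w) \<in> non_arcs (I i)} \<subseteq> {w. (v, w) \<in> non_arcs G}"
      using cover that by blast
    from card_mono[OF fin_nb this] deg[OF v]
    show "card {w. (v, w) \<in> non_arcs (I i)} \<le> k" by simp
  qed
  have "n * k \<le> (\<Sum>i<b. card (non_arcs (I i)))"
    using card_UN_le[of "{..<b}" "\<lambda>i. non_arcs (I i)"] nk cover by simp
  also have "\<dots> \<le> b * (2 * (k * k))"
    using sum_bounded_above[of "{..<b}" "\<lambda>i. card (non_arcs (I i))"] bound by simp
  \<comment> \<open>Regrouped so that one factor \<open>k\<close>, positive by assumption,
    cancels.\<close>
  finally have "n * k \<le> (b * (2 * k)) * k"
    by (simp add: algebra_simps)
  then have "n \<le> b * (2 * k)"
    using assms(1) by simp
  then have "real n \<le> real b * (2 * real k)"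
    by (metis of_nat_le_iff of_nat_mult of_nat_numeral)
  then show ?thesis
    using assms(1) unfolding b_def by (simp add: divide_le_eq)
qed

end
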